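(* Let $X$ be a topological space and let $x\in X$ be a point with network character $\mathrm{nw}_\chi(x)=\aleph_0$. Then for each finite-to-one function $\xi:\omega\to\omega$ with $\lim_{n\to\infty}|\xi^{-1}(n)|=\infty$ there is an injective sequence $(x_n)_{n\in\omega}$ in $X$ that $\mathcal F$-converges to $x$ for some $\xi$-meager filter $\mathcal F$ on $\omega$.
   Context: Network character: a family $\mathcal N$ of subsets of $X$ is an i-network at $x\in X$ if every $N\in\mathcal N$ is infinite and each neighborhood of $x$ contains some $N\in\mathcal N$. If every neighborhood of $x$ is infinite, $\mathrm{nw}_\chi(x)=\mathrm{nw}_\chi(x;X)$ is the smallest cardinality of an i-network at $x$; if some neighborhood of $x$ is finite, $\mathrm{nw}_\chi(x)=1$. A function $\xi:\omega\to\omega$ is finite-to-one if for each $y\in\omega$ the preimage $\xi^{-1}(y)$ is finite and non-empty (so $\xi$ is surjective). Filters on $\omega$ are proper. For a surjection $\xi:\omega\to\omega$, a filter $\mathcal F$ on $\omega$ is $\xi$-meager if $\xi(\mathcal F)=\{\xi(F):F\in\mathcal F\}$ equals the Fréchet filter of all cofinite subsets of $\omega$. A sequence $(x_n)_{n\in\omega}$ $\mathcal F$-converges to $x$ if $\{n\in\omega:x_n\in O\}\in\mathcal F$ for each neighborhood $O$ of $x$. A sequence is injective if $x_n\ne x_m$ for $n\ne m$. *)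

theory Defs
  imports "HOL-Analysis.Abstract_Limits"
begin

unbundle cardinal_syntax

definition nbhd_of :: "'a topology \<Rightarrow> 'a \<Rightarrow> 'a set \<Rightarrow> bool" where
  "nbhd_of X x U \<longleftrightarrow> U \<subseteq> topspace X \<and> (\<exists>V. openin X V \<and> x \<in> V \<and> V \<subseteq> U)"

definition i_network_at :: "'a topology \<Rightarrow> 'a \<Rightarrow> 'a set set \<Rightarrow> bool" where
  "i_network_at X x \<N> \<longleftrightarrow>
     (\<forall>N\<in>\<N>. N \<subseteq> topspace X \<and> infinite N) \<and>
     (\<forall>U. nbhd_of X x U \<longrightarrow> (\<exists>N\<in>\<N>. N \<subseteq> U))"

text \<open>Cardinals are represented by well-orders, compared up to \<open>=o\<close>.  In the second
  branch an i-network of least cardinality is chosen; lemma \<open>nw_char_least\<close> below shows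
  that one exists.  In the first branch the cardinal is 1, realised by a singleton.\<close>

definition nw_char :: "'a topology \<Rightarrow> 'a \<Rightarrow> 'a set rel" where
  "nw_char X x =
     (if \<forall>U. nbhd_of X x U \<longrightarrow> infinite U
      then |SOME \<N>. i_network_at X x \<N> \<and> (\<forall>\<M>. i_network_at X x \<M> \<longrightarrow> |\<N>| \<le>o |\<M>| )|
      else |{{x}}| )"

lemma nw_char_least:
  assumes "\<And>U. nbhd_of X x U \<Longrightarrow> infinite U"
  shows "\<exists>\<N>. i_network_at X x \<N> \<and> nw_char X x = |\<N>|"
    and "i_network_at X x \<M> \<Longrightarrow> nw_char X x \<le>o |\<M>|"
proof -
  let ?R = "{ |\<N>| | \<N>. i_network_at X x \<N> }"
  let ?least = "\<lambda>\<N>. i_network_at X x \<N> \<and> (\<forall>\<M>. i_network_at X x \<M> \<longrightarrow> |\<N>| \<le>o |\<M>| )"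
  have "i_network_at X x {U. nbhd_of X x U}"
    using assms by (auto simp: i_network_at_def nbhd_of_def)
  then have "?R \<noteq> {}" by auto
  moreover have "\<forall>r\<in>?R. Well_order r" using card_of_Well_order by auto
  ultimately obtain r where "r \<in> ?R" "\<forall>r'\<in>?R. r \<le>o r'"
    using exists_minim_Well_order[of ?R] by auto
  then obtain \<N> where "r = |\<N>|" "i_network_at X x \<N>" by auto
  with \<open>\<forall>r'\<in>?R. r \<le>o r'\<close> have "?least \<N>" by auto
  then have "\<exists>\<N>. ?least \<N>" by (rule exI)
  then have least: "?least (SOME \<N>. ?least \<N>)" by (rule someI_ex)
  have eq: "nw_char X x = |SOME \<N>. ?least \<N>|"
    using assms by (simp add: nw_char_def)
  show "\<exists>\<N>. i_network_at X x \<N> \<and> nw_char X x = |\<N>|" using least eq by blast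
  show "nw_char X x \<le>o |\<M>|" if "i_network_at X x \<M>" using least eq that by simp
qed

definition finite_to_one :: "(nat \<Rightarrow> nat) \<Rightarrow> bool" where
  "finite_to_one \<xi> \<longleftrightarrow> (\<forall>y. finite (\<xi> -` {y}) \<and> \<xi> -` {y} \<noteq> {})"

text \<open>A filter on \<open>\<omega>\<close> is a \<open>nat filter\<close> different from \<open>bot\<close>; a set \<open>A\<close> belongs to it
  iff membership in \<open>A\<close> holds eventually.\<close>

definition meager_filter :: "(nat \<Rightarrow> nat) \<Rightarrow> nat filter \<Rightarrow> bool" where
  "meager_filter \<xi> F \<longleftrightarrow> F \<noteq> bot \<and>
     {\<xi> ` A | A. eventually (\<lambda>n. n \<in> A) F} = {B. finite (- B)}"

end

theory Submission
  imports Defs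
begin

text \<open>Enumerate a countable i-network at \<open>x\<close> as \<open>N\<^sub>0, N\<^sub>1, \<dots>\<close>, number the elements of each
  fibre of \<open>\<xi>\<close> by \<open>0, 1, \<dots>\<close>, and choose the terms of an injective sequence so that the
  term whose index has number \<open>k\<close> lies in \<open>N\<^sub>k\<close>. As the fibres grow, almost all of
  them have an element numbered \<open>k\<close>, so the indices of terms in a neighborhood of \<open>x\<close> meet
  almost all fibres. The filter generated by these index sets and the preimages of cofinite
  sets is therefore \<open>\<xi>\<close>-meager.\<close>

text \<open>Well-founded recursion on the index: only finitely many values are already taken at
  stage \<open>i\<close>, so the infinite set \<open>M i\<close> still has a free one.\<close>

lemma injective_choice_from_infinite_sets:
  fixes M :: "nat \<Rightarrow> 'a set"
  assumes "\<And>i. infinite (M i)"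
  shows "\<exists>s. inj s \<and> (\<forall>i. s i \<in> M i)"
proof -
  have "\<exists>s. \<forall>i. s i \<in> M i \<and> s i \<notin> s ` {..<i}"
  proof (rule dependent_wf_choice[OF wf_less_than, where P = "\<lambda>s i y. y \<in> M i \<and> y \<notin> s ` {..<i}"])
    show "(y \<in> M i \<and> y \<notin> f ` {..<i}) = (y \<in> M i \<and> y \<notin> g ` {..<i})"
      if "\<And>j. (j, i) \<in> less_than \<Longrightarrow> f j = g j" for f g :: "nat \<Rightarrow> 'a" and i y
      using that by auto
    show "\<exists>y. y \<in> M i \<and> y \<notin> f ` {..<i}" for i and f :: "nat \<Rightarrow> 'a"
      using infinite_super[of "M i" "f ` {..<i}"] assms by blast
  qed
  then obtain s where s: "\<And>i. s i \<in> M i" "\<And>i. s i \<notin> s ` {..<i}" by blast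
  have "inj s"
    by (rule linorder_injI) (metis s(2) image_eqI lessThan_iff)
  with s(1) show ?thesis by blast
qed

text \<open>Fibres are disjoint, so bijections from each fibre onto an initial segment of the
  naturals glue to a single \<open>r\<close>.\<close>

lemma fibre_numbering:
  assumes "\<And>y. finite (\<xi> -` {y})"
  shows "\<exists>r :: 'a \<Rightarrow> nat. \<forall>y k. k < card (\<xi> -` {y}) \<longrightarrow> (\<exists>i. \<xi> i = y \<and> r i = k)"
proof -
  have "\<forall>y. \<exists>h. bij_betw h (\<xi> -` {y}) {0..<card (\<xi> -` {y})}"
    using assms by (intro allI ex_bij_betw_finite_nat)
  then obtain h where h: "\<And>y. bij_betw (h y) (\<xi> -` {y}) {0..<card (\<xi> -` {y})}"
    by metis
  have "\<exists>i. \<xi> i = y \<and> h (\<xi> i) i = k" if "k < card (\<xi> -` {y})" for y k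
  proof -
    have "k \<in> h y ` (\<xi> -` {y})"
      using that h[of y] by (simp add: bij_betw_def)
    then show ?thesis by auto
  qed
  then show ?thesis by (intro exI[of _ "\<lambda>i. h (\<xi> i) i"]) blast
qed

lemma nw_char_natLeq_imp_sequence:
  assumes "nw_char X x =o natLeq"
  shows "\<exists>N :: nat \<Rightarrow> 'a set. i_network_at X x (range N)"
proof -
  have "\<forall>U. nbhd_of X x U \<longrightarrow> infinite U"
  proof (rule ccontr)
    \<comment> \<open>With a finite neighborhood present, \<open>nw_char\<close> takes its default
      value, the cardinal of a singleton, which is not infinite.\<close>
    assume "\<not> ?thesis"
    then have "natLeq \<le>o |{{x}}|"
      using assms by (auto simp: nw_char_def ordIso_iff_ordLeq split: if_splits)
    then show False
      using infinite_iff_natLeq_ordLeq by blast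
  qed
  then obtain \<N> where \<N>: "i_network_at X x \<N>" "nw_char X x = |\<N>|"
    using nw_char_least(1) by metis
  have "|UNIV :: nat set| =o |\<N>|"
    using assms \<N>(2) card_of_nat ordIso_symmetric ordIso_transitive by metis
  then obtain N :: "nat \<Rightarrow> 'a set" where "bij_betw N UNIV \<N>"
    by (auto simp flip: card_of_ordIso)
  then show ?thesis using \<N>(1) by (auto simp: bij_betw_def)
qed

text \<open>Intersecting with the preimage of a cofinite set removes only finitely many points from
  an image, so the images stay cofinite; these preimages in turn make every cofinite set an
  image.\<close>

lemma meager_filter_inf_filtercomap:
  assumes "surj \<xi>"
    and "\<And>P. eventually P G \<Longrightarrow> finite (- \<xi> ` {n. P n})"
  shows "meager_filter \<xi> (inf G (filtercomap \<xi> cofinite))"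
proof -
  let ?F = "inf G (filtercomap \<xi> cofinite)"
  have finite_image: "finite (- \<xi> ` A)" if A: "\<forall>\<^sub>F n in ?F. n \<in> A" for A
  proof -
    obtain P Q where P: "eventually P G" and Q: "finite {y. \<not> Q y}"
      and PQ: "\<And>n. P n \<Longrightarrow> Q (\<xi> n) \<Longrightarrow> n \<in> A"
      using A unfolding eventually_inf eventually_filtercomap eventually_cofinite by blast
    have "- \<xi> ` A \<subseteq> - \<xi> ` {n. P n} \<union> {y. \<not> Q y}"
      using PQ by blast
    then show ?thesis
      using assms(2)[OF P] Q by (meson finite_UnI finite_subset)
  qed
  have "\<exists>A. B = \<xi> ` A \<and> (\<forall>\<^sub>F n in ?F. n \<in> A)" if "finite (- B)" for B
  proof (intro exI conjI)
    show "B = \<xi> ` (\<xi> -` B)" using assms(1) by (simp add: surj_image_vimage_eq)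
    have "\<forall>\<^sub>F y in cofinite. y \<in> B"
      using that by (simp add: eventually_cofinite Compl_eq)
    then have "\<forall>\<^sub>F n in filtercomap \<xi> cofinite. n \<in> \<xi> -` B"
      by (auto simp: eventually_filtercomap)
    then show "\<forall>\<^sub>F n in ?F. n \<in> \<xi> -` B"
      by (rule filter_leD[OF inf_le2])
  qed
  \<comment> \<open>In an improper filter the empty set would be a member, but its image is not
    cofinite.\<close>
  moreover have "?F \<noteq> bot"
    using finite_image[of "{}"] by auto
  ultimately show ?thesis
    using finite_image unfolding meager_filter_def by blast
qed

theorem theorem2:
  fixes X :: "'a topology" and x :: 'a and \<xi> :: "nat \<Rightarrow> nat"
  assumes "x \<in> topspace X"
    and "nw_char X x =o natLeq"
    and "finite_to_one \<xi>"
    and "filterlim (\<lambda>n. card (\<xi> -` {n})) at_top sequentially"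
  shows "\<exists>(s :: nat \<Rightarrow> 'a) F. inj s \<and> range s \<subseteq> topspace X \<and>
           meager_filter \<xi> F \<and> limitin X s x F"
proof -
  obtain N :: "nat \<Rightarrow> 'a set" where N: "i_network_at X x (range N)"
    using nw_char_natLeq_imp_sequence[OF assms(2)] by blast
  have fibres: "\<And>y. finite (\<xi> -` {y})"
    using assms(3) by (simp add: finite_to_one_def)
  have "\<exists>i. \<xi> i = y" for y
    using assms(3) by (auto simp: finite_to_one_def vimage_def)
  then have "surj \<xi>" by (metis surj_def)
  obtain r where r: "\<And>y k. k < card (\<xi> -` {y}) \<Longrightarrow> \<exists>i. \<xi> i = y \<and> r i = k"
    using fibre_numbering[of \<xi>, OF fibres] by blast
  have "\<And>i. infinite (N (r i))"
    using N by (auto simp: i_network_at_def)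
  then obtain s where "inj s" and s: "\<And>i. s i \<in> N (r i)"
    using injective_choice_from_infinite_sets[of "\<lambda>i. N (r i)"] by blast
  have "range s \<subseteq> topspace X"
    using N s by (fastforce simp: i_network_at_def)
  \<comment> \<open>The coarsest filter along which \<open>s\<close> converges to
    \<open>x\<close>.\<close>
  define G where "G = filtercomap s (nhdsin X x)"
  have "finite (- \<xi> ` {n. P n})" if P: "eventually P G" for P
  proof -
    obtain U where U: "openin X U" "x \<in> U" "\<And>n. s n \<in> U \<Longrightarrow> P n"
      using P assms(1) unfolding G_def by (auto simp: eventually_filtercomap eventually_nhdsin)
    then have "nbhd_of X x U"
      using openin_subset by (auto simp: nbhd_of_def)
    then obtain k where "N k \<subseteq> U"
      using N by (auto simp: i_network_at_def)
    have "\<forall>\<^sub>F y in sequentially. k < card (\<xi> -` {y})"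
      using assms(4) unfolding filterlim_at_top Suc_le_eq[symmetric] by blast
    \<comment> \<open>The index \<open>i\<close> numbered \<open>k\<close> in the fibre over
      \<open>y\<close> has \<open>s i\<close> in \<open>N k\<close>, hence in
      \<open>U\<close>.\<close>
    moreover have "y \<in> \<xi> ` {n. P n}" if "k < card (\<xi> -` {y})" for y
      using r[OF that] s \<open>N k \<subseteq> U\<close> U(3) by blast
    ultimately have "\<forall>\<^sub>F y in cofinite. y \<in> \<xi> ` {n. P n}"
      unfolding cofinite_eq_sequentially by (auto elim: eventually_mono)
    then show ?thesis by (simp add: eventually_cofinite Compl_eq)
  qed
  then have "meager_filter \<xi> (inf G (filtercomap \<xi> cofinite))"
    by (rule meager_filter_inf_filtercomap[OF \<open>surj \<xi>\<close>])
  \<comment> \<open>Convergence along \<open>G\<close> persists, since the meet only adds sets to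
    the filter.\<close>
  moreover have "limitin X s x (inf G (filtercomap \<xi> cofinite))"
    unfolding limitin_def
  proof (intro conjI allI impI assms(1))
    fix U assume "openin X U \<and> x \<in> U"
    then have "\<forall>\<^sub>F n in G. s n \<in> U"
      using assms(1) by (auto simp: G_def eventually_filtercomap eventually_nhdsin)
    then show "\<forall>\<^sub>F n in inf G (filtercomap \<xi> cofinite). s n \<in> U"
      by (rule filter_leD[OF inf_le1])
  qed
  ultimately show ?thesis
    using \<open>inj s\<close> \<open>range s \<subseteq> topspace X\<close> by blast
qed

end
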